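(* For every positive integer $N$, there is some $\varphi\in\mathbb{C}^N$ such that $(\varphi,(\mathbb{Z}/N\mathbb{Z})^2)$ is in general linear position. Moreover, the set of such $\varphi$ is of full measure: its complement in $\mathbb{C}^N$ has Lebesgue measure zero.
   Context: Let $N$ be a positive integer and $\omega=e^{2\pi i/N}$. Define the linear operators $T,M:\mathbb{C}^N\to\mathbb{C}^N$ by $$T(x_0,x_1,\dots,x_{N-1})=(x_{N-1},x_0,\dots,x_{N-2}),\qquad M(x_0,x_1,\dots,x_{N-1})=(x_0,\omega x_1,\dots,\omega^{N-1}x_{N-1}),$$ and for $(\kappa,\lambda)\in(\mathbb{Z}/N\mathbb{Z})^2$ put $\pi(\kappa,\lambda)=M^{\lambda}T^{\kappa}$ (well defined since $M^N=T^N=\mathrm{Id}$). For $\varphi\in\mathbb{C}^N$ and $\Lambda\subseteq(\mathbb{Z}/N\mathbb{Z})^2$, the Gabor frame $(\varphi,\Lambda)$ is the family of vectors $\pi(\kappa,\lambda)\varphi$, $(\kappa,\lambda)\in\Lambda$. It is said to be in general linear position if for every $\Lambda'\subseteq\Lambda$ with $|\Lambda'|=N$ the family $(\varphi,\Lambda')$ is a basis of $\mathbb{C}^N$. *)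

theory Defs
  imports "HOL-Analysis.Analysis" "Berlekamp_Zassenhaus.Finite_Field"
begin

text \<open>
  With \<open>N = CARD('n)\<close>, the type \<open>'n mod_ring\<close> is \<open>\<int>/N\<int>\<close>, and \<open>\<complex>\<^sup>N\<close> is
  \<open>complex ^ ('n mod_ring)\<close>: the coordinate \<open>x\<^sub>j\<close>, \<open>0 \<le> j < N\<close>, sits at the class of \<open>j\<close>.
  The bare numeral \<open>1 :: 'n mod_ring\<close> is available in the library only for \<open>N > 1\<close>; since
  \<open>N = 1\<close> is included here, the class of \<open>1\<close> is written \<open>of_int_mod_ring 1\<close>.
\<close>

definition residue :: "'n::finite mod_ring \<Rightarrow> nat" where
  "residue k = nat (to_int_mod_ring k)"

definition unit_root :: "nat \<Rightarrow> complex" where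
  "unit_root N = exp (2 * of_real pi * \<i> / of_nat N)"

definition translation :: "complex ^ ('n::finite mod_ring) \<Rightarrow> complex ^ ('n mod_ring)" where
  "translation x = (\<chi> j. x $ (j - of_int_mod_ring 1))"

definition modulation :: "complex ^ ('n::finite mod_ring) \<Rightarrow> complex ^ ('n mod_ring)" where
  "modulation x = (\<chi> j. unit_root CARD('n) ^ residue j * x $ j)"

text \<open>The exponents are the representatives in \<open>{0..<N}\<close>; by \<open>translation_period\<close> and
  \<open>modulation_period\<close> below, any other representatives give the same operator.\<close>

definition tf_shift ::
    "'n::finite mod_ring \<times> 'n mod_ring \<Rightarrow> complex ^ ('n mod_ring) \<Rightarrow> complex ^ ('n mod_ring)" where
  "tf_shift = (\<lambda>(k, l). (modulation ^^ residue l) \<circ> (translation ^^ residue k))"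

text \<open>Indexed families: \<open>vec.independent\<close> and \<open>vec.span\<close> (over the scalars \<open>\<complex>\<close>) only see the set
  of members, so repeated members have to be excluded by injectivity.\<close>

definition basis_family :: "('i \<Rightarrow> complex ^ 'm::finite) \<Rightarrow> 'i set \<Rightarrow> bool" where
  "basis_family v I \<longleftrightarrow>
     inj_on v I \<and> vec.independent (v ` I) \<and> vec.span (v ` I) = UNIV"

definition general_linear_position ::
    "complex ^ ('n::finite mod_ring) \<Rightarrow> ('n mod_ring \<times> 'n mod_ring) set \<Rightarrow> bool" where
  "general_linear_position \<phi> \<Lambda> \<longleftrightarrow>
     (\<forall>\<Lambda>'. \<Lambda>' \<subseteq> \<Lambda> \<and> card \<Lambda>' = CARD('n) \<longrightarrow> basis_family (\<lambda>p. tf_shift p \<phi>) \<Lambda>')"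

lemma translation_nth: "translation x $ j = x $ (j - of_int_mod_ring 1)"
  by (simp add: translation_def)

lemma translation_funpow:
  fixes x :: "complex ^ ('n::finite mod_ring)"
  shows "(translation ^^ m) x = (\<chi> j. x $ (j - of_int_mod_ring (int m)))"
proof (induction m)
  case 0
  then show ?case by (simp add: vec_eq_iff)
next
  case (Suc m)
  have "j - of_int_mod_ring 1 - of_int_mod_ring (int m) = j - of_int_mod_ring (int (Suc m))"
    for j :: "'n mod_ring"
    by transfer (simp add: mod_simps algebra_simps)
  then show ?case
    by (simp only: funpow.simps o_apply Suc.IH translation_nth vec_eq_iff vec_lambda_beta simp_thms)
qed

lemma translation_period: "(translation ^^ CARD('n)) x = (x :: complex ^ ('n::finite mod_ring))"
proof -
  have "of_int_mod_ring (int CARD('n)) = (0 :: 'n mod_ring)"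
    by transfer simp
  then show ?thesis by (simp add: translation_funpow vec_eq_iff)
qed

lemma unit_root_power: "N > 0 \<Longrightarrow> unit_root N ^ N = 1"
  by (simp add: unit_root_def flip: exp_of_nat_mult)

lemma modulation_nth:
  fixes x :: "complex ^ ('n::finite mod_ring)"
  shows "modulation x $ j = unit_root CARD('n) ^ residue j * x $ j"
  by (simp add: modulation_def)

lemma modulation_funpow:
  fixes x :: "complex ^ ('n::finite mod_ring)"
  shows "(modulation ^^ m) x = (\<chi> j. (unit_root CARD('n) ^ residue j) ^ m * x $ j)"
  by (induction m) (simp_all add: modulation_nth vec_eq_iff)

lemma modulation_period: "(modulation ^^ CARD('n)) x = (x :: complex ^ ('n::finite mod_ring))"
proof -
  have "(unit_root CARD('n) ^ k) ^ CARD('n) = 1" for k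
    by (metis power_commutes power_mult mult.commute power_one unit_root_power zero_less_card_finite)
  then show ?thesis by (simp add: modulation_funpow vec_eq_iff)
qed

end

theory Submission
  imports Defs "HOL-Real_Asymp.Real_Asymp"
begin

text \<open>
  Let \<open>N = CARD('n)\<close>. For a set of \<open>N\<close> shifts \<open>(\<kappa>\<^sub>l, \<lambda>\<^sub>l)\<close>, the vectors \<open>\<pi>(\<kappa>\<^sub>l, \<lambda>\<^sub>l) \<phi>\<close> form a basis iff the
  Gabor matrix with entries \<open>\<omega> ^ (\<lambda>\<^sub>l * j) * \<phi> (j - \<kappa>\<^sub>l)\<close> is nonsingular. There are finitely many such sets,
  and a null set of bad windows has a nonempty complement; so both claims follow once, for each set,
  the windows with singular Gabor matrix form a null set.

  For this a single window \<open>\<psi>\<close> with nonsingular matrix is enough. The matrix is linear in the window,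
  so every line parallel to \<open>\<psi>\<close> meets the singular windows in finitely many points
  (\<open>finite_singular_on_line\<close>), and Tonelli's theorem gives measure zero
  (\<open>null_set_if_null_on_parallel_lines\<close>).

  To find \<open>\<psi>\<close>, sort the shifts by \<open>\<kappa>\<close> and take \<open>\<psi> r = exp (- \<beta> * w r)\<close> with \<open>\<beta>\<close> large. Every term of the
  Leibniz expansion belongs to an assignment of the rows \<open>j\<close> to the columns \<open>l\<close>, and has modulus
  \<open>exp (- \<beta> * cost)\<close>, where the assignment costs the sum of all \<open>w (j - \<kappa>\<^sub>l)\<close>. If \<open>w\<close> is the squared distance
  to a suitable centre on the circle \<open>\<int>/N\<close>, convexity makes the sorted assignment cheapest, and the
  only other cheapest ones permute rows among columns with the same \<open>\<kappa>\<close>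
  (\<open>circular_transport_potentials\<close>). In the limit the determinant is therefore governed by a
  block diagonal matrix. The rows of a block are consecutive, so each block is a Vandermonde
  matrix in the distinct numbers \<open>\<omega> ^ \<lambda>\<^sub>l\<close> up to nonzero column factors, and its determinant is nonzero
  (\<open>block_matrix_det_nonzero\<close>). Dual potentials for the transport problem replace the bookkeeping
  with permutations: they rescale rows and columns so that the matrix itself converges to the
  block matrix (\<open>gabor_matrix_nonsingular_exists\<close>).
\<close>

section \<open>Optimal transport on the circle\<close>

lemma discrete_antiderivative:
  fixes h :: "int \<Rightarrow> int"
  obtains G where "\<And>x. G (x + 1) = G x + h x"
proof
  fix x :: int
  let ?G = "\<lambda>x. sum h {0..<x} - sum h {x..<0}"
  show "?G (x + 1) = ?G x + h x"
  proof (cases "x \<ge> 0")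
    case True
    then have "{0..<x + 1} = insert x {0..<x}" by auto
    then show ?thesis using True by simp
  next
    case False
    then have "{x..<0} = insert x {x + 1..<0}" by auto
    then show ?thesis using False by simp
  qed
qed

text \<open>
  The function \<open>G\<close> is, up to a factor of two, the trapezoidal primitive of a monotone sequence,
  so it is discretely convex and \<open>2 * k l\<close> is a subgradient at \<open>l\<close>. With the trapezoidal rule,
  unlike a one-sided one, every step in either direction that leaves the value \<open>k l\<close> has a slope
  different from \<open>2 * k l\<close>. This yields the term \<open>\<bar>k x - k l\<bar>\<close>, which detects whether \<open>x\<close> and \<open>l\<close> lie
  on the same level of \<open>k\<close>.
\<close>

lemma convex_subgradient:
  fixes k G :: "int \<Rightarrow> int"
  assumes "mono k" and step: "\<And>x. G (x + 1) = G x + (k x + k (x + 1))"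
  shows "\<bar>k x - k l\<bar> \<le> G x - G l - 2 * (x - l) * k l"
proof (cases "l \<le> x")
  case True
  then show ?thesis
  proof (induction x rule: int_ge_induct)
    case (step x)
    have "k l \<le> k x" "k x \<le> k (x + 1)" using step.hyps \<open>mono k\<close> by (auto simp: monoD)
    then show ?case using step.IH assms(2)[of x] by (simp add: algebra_simps)
  qed simp
next
  case False
  then have "x \<le> l" by simp
  then show ?thesis
  proof (induction x rule: int_le_induct)
    case (step x)
    have "k x \<le> k l" "k (x - 1) \<le> k x" using step.hyps \<open>mono k\<close> by (auto simp: monoD)
    then show ?case using step.IH assms(2)[of "x - 1"] by (simp add: algebra_simps)
  qed simp
qed

text \<open>
  Since \<open>k\<close> grows by \<open>N\<close> per period, its primitive is a periodic function plus a quadratic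
  polynomial with leading term \<open>x\<^sup>2\<close>. Hence in \<open>x\<^sup>2 - G x\<close> the quadratic growth cancels, and
  passing from \<open>x\<close> to \<open>x + N * e\<close> changes it by \<open>e * (N\<^sup>2 - C)\<close>. The constant \<open>C\<close> never has to be computed:
  it is absorbed in the choice of a centre below.
\<close>

lemma quasi_periodic_antiderivative:
  fixes k G :: "int \<Rightarrow> int"
  assumes quasi: "\<And>x. k (x + N) = k x + N"
    and step: "\<And>x. G (x + 1) = G x + (k x + k (x + 1))"
  obtains C where "\<And>x e. G (x + N * e) = G x + e * C + 2 * N * x * e + N\<^sup>2 * e * (e - 1)"
proof
  have period: "G (x + N) = G x + (G N - G 0) + 2 * N * x" for x
  proof (induction x rule: int_induct[of _ 0])
    case (step1 x)
    then show ?case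
      using assms(2)[of "x + N"] assms(2)[of x] quasi[of x] quasi[of "x + 1"]
      by (simp add: algebra_simps)
  next
    case (step2 x)
    then show ?case
      using assms(2)[of "x + N - 1"] assms(2)[of "x - 1"] quasi[of x] quasi[of "x - 1"]
      by (simp add: algebra_simps)
  qed simp
  fix x e
  show "G (x + N * e) = G x + e * (G N - G 0) + 2 * N * x * e + N\<^sup>2 * e * (e - 1)"
  proof (induction e rule: int_induct[of _ 0])
    case (step1 e)
    then show ?case using period[of "x + N * e"] by (simp add: algebra_simps power2_eq_square)
  next
    case (step2 e)
    then show ?case using period[of "x + N * (e - 1)"] by (simp add: algebra_simps power2_eq_square)
  qed simp
qed

lemma quasi_periodic_extension_mono:
  fixes \<kappa> :: "int \<Rightarrow> int"
  assumes "N > 0" and "mono_on {0..<N} \<kappa>" and "\<kappa> ` {0..<N} \<subseteq> {0..<N}"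
  shows "mono (\<lambda>y. \<kappa> (y mod N) + N * (y div N))"
proof (rule monoI)
  fix y z :: int
  assume "y \<le> z"
  have mods: "y mod N \<in> {0..<N}" "z mod N \<in> {0..<N}" using \<open>N > 0\<close> by simp_all
  then have range: "\<kappa> (y mod N) < N" "0 \<le> \<kappa> (z mod N)" using assms(3) by (meson atLeastLessThan_iff image_subset_iff)+
  have "y div N \<le> z div N" using \<open>y \<le> z\<close> \<open>N > 0\<close> by (simp add: zdiv_mono1)
  then consider "y div N = z div N" | "y div N + 1 \<le> z div N" by linarith
  then show "\<kappa> (y mod N) + N * (y div N) \<le> \<kappa> (z mod N) + N * (z div N)"
  proof cases
    case 1
    have "y mod N \<le> z mod N"
      using \<open>y \<le> z\<close> 1 by (simp flip: minus_mult_div_eq_mod)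
    then show ?thesis using 1 mono_onD[OF assms(2)] mods by auto
  next
    case 2
    then have "N * (y div N + 1) \<le> N * (z div N)" using \<open>N > 0\<close> by (intro mult_left_mono) auto
    then show ?thesis using range by (simp add: algebra_simps)
  qed
qed

text \<open>
  Kantorovich potentials \<open>a\<close>, \<open>b\<close> for the assignment of points \<open>i\<close> to targets \<open>\<kappa> l\<close> with the \<open>N\<close>-periodic
  cost \<open>w\<close>: an assignment is optimal iff it maps every \<open>i\<close> to an \<open>l\<close> with \<open>\<kappa> l = \<kappa> i\<close>.
\<close>

definition transport_potentials ::
    "int \<Rightarrow> (int \<Rightarrow> int) \<Rightarrow> (int \<Rightarrow> real) \<Rightarrow> (int \<Rightarrow> real) \<Rightarrow> (int \<Rightarrow> real) \<Rightarrow> bool" where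
  "transport_potentials N \<kappa> w a b \<longleftrightarrow>
     (\<forall>x e. w (x + N * e) = w x) \<and>
     (\<forall>i \<in> {0..<N}. \<forall>l \<in> {0..<N}.
        a i + b l \<le> w (i - \<kappa> l) \<and> (w (i - \<kappa> l) = a i + b l \<longleftrightarrow> \<kappa> i = \<kappa> l))"

text \<open>
  Optimal transport on the circle \<open>\<int>/N\<close>: the sorted assignment of the points \<open>i\<close> to the targets
  \<open>\<kappa> l\<close> is optimal for the cost \<open>w (i - \<kappa> l)\<close>, where \<open>w x\<close> is the squared distance from \<open>x\<close> to
  \<open>c + N\<int>\<close> for a suitable centre \<open>c\<close>, and \<open>a\<close>, \<open>b\<close> are the dual potentials that certify this. The
  inequality is an equality exactly inside the blocks on which \<open>\<kappa>\<close> is constant.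

  Expanding \<open>(x - k l - c)\<^sup>2\<close> for a lift \<open>x = i + N * e\<close> of \<open>i\<close> leaves the mixed term \<open>- 2 * x * k l\<close>,
  which the subgradient inequality decouples into a function of \<open>x\<close> and a function of \<open>l\<close>. The
  centre \<open>c\<close> is the one for which the function of \<open>x\<close> is \<open>N\<close>-periodic, so that the potential
  depends on \<open>i\<close> and not on the lift.
\<close>

lemma circular_transport_potentials:
  fixes \<kappa> :: "int \<Rightarrow> int"
  assumes N: "N > 0" and "mono_on {0..<N} \<kappa>" and \<kappa>: "\<kappa> ` {0..<N} \<subseteq> {0..<N}"
  obtains w a b where "transport_potentials N \<kappa> w a b"
proof -
  define k where "k = (\<lambda>y. \<kappa> (y mod N) + N * (y div N))"
  have "mono k" unfolding k_def by (rule quasi_periodic_extension_mono) fact+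
  have quasi_e: "k (x + N * e) = k x + N * e" for x e
    using N by (simp add: k_def algebra_simps)
  have quasi: "k (x + N) = k x + N" for x using quasi_e[of x 1] by simp
  have k_eq: "k i = \<kappa> i" if "i \<in> {0..<N}" for i using that by (simp add: k_def)
  obtain G where step: "\<And>x. G (x + 1) = G x + (k x + k (x + 1))"
    using discrete_antiderivative[of "\<lambda>x. k x + k (x + 1)"] by blast
  obtain C where C: "\<And>x e. G (x + N * e) = G x + e * C + 2 * N * x * e + N\<^sup>2 * e * (e - 1)"
    using quasi_periodic_antiderivative[OF quasi step] by blast
  note subgradient = convex_subgradient[OF \<open>mono k\<close> step]
  define c :: real where "c = (N\<^sup>2 - C) / (2 * N)"
  have c: "2 * N * c = N\<^sup>2 - C" using N by (simp add: c_def)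
  \<comment> \<open>The squared distance from \<open>x\<close> to the nearest point of \<open>c + N\<int>\<close>.\<close>
  define w :: "int \<Rightarrow> real"
    where "w = (\<lambda>x. (x - c - N * round ((x - c) / N))\<^sup>2)"
  define a :: "int \<Rightarrow> real" where "a = (\<lambda>i. i\<^sup>2 - G i - 2 * c * i)"
  define b :: "int \<Rightarrow> real" where "b = (\<lambda>l. G l - 2 * l * k l + (k l + c)\<^sup>2)"

  have w_periodic: "w (x + N * e) = w x" for x e
  proof -
    have "(x + N * e - c) / N = (x - c) / N + e" using N by (simp add: field_simps)
    moreover have "round ((x - c) / N + real_of_int e) = round ((x - c) / N) + e"
      unfolding round_def by (metis add.assoc add.commute floor_add_int)
    ultimately show ?thesis by (simp add: w_def algebra_simps)
  qed
  have w_le: "w x \<le> (x - c)\<^sup>2" for x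
  proof -
    let ?y = "(x - c) / N"
    have "\<bar>?y - round ?y\<bar> \<le> \<bar>?y\<bar>"
      using round_diff_minimal[of ?y 0] by simp
    then have "(real_of_int N)\<^sup>2 * (?y - round ?y)\<^sup>2 \<le> (real_of_int N)\<^sup>2 * ?y\<^sup>2"
      by (intro mult_left_mono) (simp_all only: abs_le_square_iff zero_le_power2)
    moreover have "x - c - N * m = N * (?y - m)" for m :: int using N by (simp add: field_simps)
    then have "w x = (real_of_int N)\<^sup>2 * (?y - round ?y)\<^sup>2"
      unfolding w_def by (simp only: power_mult_distrib)
    moreover have "(real_of_int N)\<^sup>2 * ?y\<^sup>2 = (x - c)\<^sup>2" using N by (simp add: power_divide)
    ultimately show ?thesis by simp
  qed
  have w_attained: "\<exists>e. w x = (x + N * e - c)\<^sup>2" for x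
    by (rule exI[of _ "- round ((x - c) / N)"]) (simp add: w_def algebra_simps)

  \<comment> \<open>The parameter \<open>e\<close> occurs only in the convexity gap: this is the effect of the choice of \<open>c\<close>.\<close>
  have split: "(i + N * e - k l - c)\<^sup>2
      = a i + b l + (G (i + N * e) - G l - 2 * (i + N * e - l) * k l)" for i e l
  proof -
    have "real_of_int (G (i + N * e)) = G i + e * (N\<^sup>2 - 2 * N * c) + 2 * N * i * e + N\<^sup>2 * e * (e - 1)"
      using c by (simp add: C)
    then show ?thesis unfolding a_def b_def
      by (simp add: power2_eq_square algebra_simps)
  qed
  have lower: "a i + b l + \<bar>k i + N * e - k l\<bar> \<le> w (i - k l)"
    if "w (i - k l) = (i - k l + N * e - c)\<^sup>2" for i l e
  proof -
    have "real_of_int \<bar>k (i + N * e) - k l\<bar> \<le> G (i + N * e) - G l - 2 * (i + N * e - l) * k l"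
      using subgradient[of "i + N * e" l] by (simp only: of_int_le_iff)
    then show ?thesis using split[of i e l] that by (simp add: quasi_e algebra_simps)
  qed

  show thesis
  proof (rule that, unfold transport_potentials_def, intro conjI allI ballI)
    show "w (x + N * e) = w x" for x e by (rule w_periodic)
  next
    fix i l assume il: "i \<in> {0..<N}" "l \<in> {0..<N}"
    obtain e where e: "w (i - k l) = (i - k l + N * e - c)\<^sup>2"
      using w_attained[of "i - k l"] by auto
    show "a i + b l \<le> w (i - \<kappa> l)"
      using lower[OF e] il by (simp add: k_eq)
    show "w (i - \<kappa> l) = a i + b l \<longleftrightarrow> \<kappa> i = \<kappa> l"
    proof
      assume "w (i - \<kappa> l) = a i + b l"
      then have "real_of_int (\<kappa> i + N * e) = real_of_int (\<kappa> l)"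
        using lower[OF e] il by (simp add: k_eq)
      then have "\<kappa> i + N * e = \<kappa> l" by (simp only: of_int_eq_iff)
      moreover have "\<kappa> i \<in> {0..<N}" "\<kappa> l \<in> {0..<N}" using il \<kappa> by (meson image_subset_iff)+
      ultimately show "\<kappa> i = \<kappa> l"
        by (metis atLeastLessThan_iff mod_mult_self2 mod_pos_pos_trivial)
    next
      assume "\<kappa> i = \<kappa> l"
      then have eq: "k i = k l" using il by (simp add: k_eq)
      \<comment> \<open>On a common level of \<open>k\<close> the subgradient inequalities at \<open>i\<close> and at \<open>l\<close> are opposite.\<close>
      have "G i - G l - 2 * (i - l) * k l = 0"
        using subgradient[of i l] subgradient[of l i] eq by (simp add: algebra_simps)
      then have "real_of_int (G i) - G l - 2 * (i - l) * k l = 0"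
        by (simp flip: of_int_eq_0_iff[where 'a = real])
      then have "(i - k l - c)\<^sup>2 = a i + b l"
        using split[of i 0 l] by simp
      then show "w (i - \<kappa> l) = a i + b l"
        using w_le[of "i - k l"] lower[OF e] il by (simp add: k_eq)
    qed
  qed
qed

section \<open>Nonsingular matrices\<close>

lemma det_nonzero_iff_kernel_trivial:
  fixes A :: "complex ^ 'm::finite ^ 'm"
  shows "det A \<noteq> 0 \<longleftrightarrow> (\<forall>x. A *v x = 0 \<longrightarrow> x = 0)"
  by (simp add: matrix_left_invertible_ker invertible_left_inverse flip: invertible_det_nz)

lemma basis_family_if_det_nonzero:
  fixes v :: "'i \<Rightarrow> complex ^ 'm::finite"
  assumes p: "bij_betw p UNIV P" and det: "det (\<chi> j l. v (p l) $ j) \<noteq> 0"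
  shows "basis_family v P"
proof -
  define A where "A = (\<chi> j l. v (p l) $ j)"
  have column: "column l A = v (p l)" for l
    by (simp add: A_def column_def vec_eq_iff)
  have columns: "columns A = v ` P"
    using p by (auto simp: columns_def column bij_betw_def)
  have "inj_on v P"
  proof (rule inj_onI)
    fix x y assume "x \<in> P" "y \<in> P" "v x = v y"
    then obtain l m where lm: "x = p l" "y = p m" using p by (auto simp: bij_betw_def)
    then have "column l A = column m A" using \<open>v x = v y\<close> by (simp add: column)
    then show "x = y" using det_identical_columns[of l m A] det lm by (auto simp: A_def)
  qed
  moreover have "\<not> vec.dependent (rows (transpose A))"
    using det_dependent_rows[of "transpose A"] det by (auto simp: A_def)
  moreover have "invertible A" using det by (simp add: invertible_det_nz A_def)
  then have "vec.span (columns A) = UNIV"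
    by (auto simp: invertible_def simp flip: matrix_right_invertible_span_columns)
  ultimately show ?thesis by (simp add: basis_family_def columns)
qed

text \<open>
  The matrix \<open>z l ^ (a + i)\<close> is a Vandermonde matrix with column \<open>l\<close> scaled by \<open>z l ^ a\<close>. Combining its
  rows with the coefficients of the polynomial that vanishes at all nodes except \<open>z m\<close> isolates \<open>c m\<close>.
\<close>

lemma vandermonde_kernel_trivial:
  fixes z c :: "'a \<Rightarrow> complex"
  assumes S: "finite S" and inj: "inj_on z S" and nz: "\<And>l. l \<in> S \<Longrightarrow> z l \<noteq> 0"
    and zero: "\<And>i. i < card S \<Longrightarrow> (\<Sum>l\<in>S. z l ^ (a + i) * c l) = 0"
    and m: "m \<in> S"
  shows "c m = 0"
proof -
  define q where "q = (\<Prod>l\<in>S - {m}. [:- z l, 1:])"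
  have deg: "degree q < card S"
  proof -
    have "degree q \<le> (\<Sum>l\<in>S - {m}. degree [:- z l, 1:])"
      unfolding q_def using S degree_prod_sum_le[of "S - {m}" "\<lambda>l. [:- z l, 1:]"] by (simp add: o_def)
    also have "\<dots> = card S - 1" using S m by simp
    also have "\<dots> < card S" using S m by (intro diff_less) (auto simp: card_gt_0_iff)
    finally show ?thesis .
  qed
  have q: "poly q (z l) = 0 \<longleftrightarrow> l \<noteq> m" if "l \<in> S" for l
    using that S inj m by (auto simp: q_def poly_prod inj_on_eq_iff)
  have "0 = (\<Sum>i\<le>degree q. Polynomial.coeff q i * (\<Sum>l\<in>S. z l ^ (a + i) * c l))"
    using zero deg by simp
  also have "\<dots> = (\<Sum>i\<le>degree q. \<Sum>l\<in>S. z l ^ a * (Polynomial.coeff q i * z l ^ i) * c l)"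
    by (simp add: sum_distrib_left power_add mult_ac)
  also have "\<dots> = (\<Sum>l\<in>S. \<Sum>i\<le>degree q. z l ^ a * (Polynomial.coeff q i * z l ^ i) * c l)"
    by (rule sum.swap)
  also have "\<dots> = (\<Sum>l\<in>S. z l ^ a * poly q (z l) * c l)"
    by (simp add: poly_altdef sum_distrib_left sum_distrib_right mult_ac)
  also have "\<dots> = z m ^ a * poly q (z m) * c m"
    using S m q by (subst sum.remove[of _ m]) (auto intro!: sum.neutral)
  finally show ?thesis using q[OF m] nz[OF m] by simp
qed

lemma tendsto_det:
  fixes A :: "'b \<Rightarrow> complex ^ 'm::finite ^ 'm"
  assumes "\<And>i j. ((\<lambda>x. A x $ i $ j) \<longlongrightarrow> B $ i $ j) F"
  shows "((\<lambda>x. det (A x)) \<longlongrightarrow> det B) F"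
  unfolding det_def by (intro tendsto_intros assms)

text \<open>
  The determinant of \<open>B + s A\<close> is a polynomial in \<open>s\<close> whose constant term is \<open>det B\<close>, so it has finitely
  many roots; for \<open>t \<noteq> 0\<close>, the matrix \<open>A + t B\<close> is a multiple of \<open>B + s A\<close> with \<open>s = 1 / t\<close>.
\<close>

lemma finite_singular_on_line:
  fixes A B :: "complex ^ 'm::finite ^ 'm"
  assumes "det B \<noteq> 0"
  shows "finite {t::real. det (\<chi> i j. A $ i $ j + of_real t * B $ i $ j) = 0}"
proof -
  \<comment> \<open>The reversed polynomial is used because its nonvanishing can be read off at \<open>s = 0\<close>.\<close>
  define q where "q = det (\<chi> i j. [:B $ i $ j, A $ i $ j:])"
  have q: "poly q s = det (\<chi> i j. B $ i $ j + s * A $ i $ j)" for s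
    by (simp add: q_def det_def poly_sum poly_prod)
  have "(\<chi> i j. B $ i $ j + 0 * A $ i $ j) = B" by (simp add: vec_eq_iff)
  then have "q \<noteq> 0" using assms q[of 0] by auto
  have "{t::real. det (\<chi> i j. A $ i $ j + of_real t * B $ i $ j) = 0}
    \<subseteq> insert 0 ((\<lambda>s. Re (inverse s)) ` {s. poly q s = 0})"
  proof safe
    fix t :: real
    assume t: "det (\<chi> i j. A $ i $ j + of_real t * B $ i $ j) = 0"
      and "t \<notin> (\<lambda>s. Re (inverse s)) ` {s. poly q s = 0}"
    moreover have "t = Re (inverse (inverse (of_real t)))" by simp
    ultimately have nonroot: "poly q (inverse (of_real t)) \<noteq> 0" by blast
    show "t = 0"
    proof (rule ccontr)
      assume "t \<noteq> 0"
      then have "(\<chi> i j. A $ i $ j + of_real t * B $ i $ j)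
        = (\<chi> i. of_real t *s (\<chi> j. B $ i $ j + inverse (of_real t) * A $ i $ j))"
        by (simp add: vec_eq_iff field_simps)
      then have "det (\<chi> i j. A $ i $ j + of_real t * B $ i $ j)
          = of_real t ^ CARD('m) * poly q (inverse (of_real t))"
        by (simp add: det_rows_mul q)
      then show False using t nonroot \<open>t \<noteq> 0\<close> by simp
    qed
  qed
  then show ?thesis
    using poly_roots_finite[OF \<open>q \<noteq> 0\<close>] by (meson finite_imageI finite_insert finite_subset)
qed

section \<open>Null sets from parallel lines\<close>

text \<open>
  Integrate the indicator of \<open>Z\<close> at \<open>x + t v\<close> over all \<open>(x, t)\<close>. Integrating over \<open>t\<close> first gives 0;
  integrating over \<open>x\<close> first gives the measure of \<open>Z\<close> for every \<open>t\<close> by translation invariance, hence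
  infinity times that measure. By Tonelli the measure of \<open>Z\<close> is 0. Integrating over the product avoids
  a choice of coordinates adapted to \<open>v\<close>.
\<close>

lemma null_set_if_null_on_parallel_lines:
  fixes Z :: "'a::euclidean_space set"
  assumes Z: "Z \<in> sets borel" and lines: "\<And>x. countable {t::real. x + t *\<^sub>R v \<in> Z}"
  shows "Z \<in> null_sets lborel"
proof -
  let ?f = "\<lambda>(x::'a) (t::real). indicator Z (x + t *\<^sub>R v) :: ennreal"
  have f: "case_prod ?f \<in> borel_measurable (lborel \<Otimes>\<^sub>M lborel)"
    using Z by measurable
  have line: "(\<integral>\<^sup>+t. ?f x t \<partial>lborel) = 0" for x
  proof -
    have "(\<integral>\<^sup>+t. ?f x t \<partial>lborel) = (\<integral>\<^sup>+t. indicator {t. x + t *\<^sub>R v \<in> Z} t \<partial>lborel)"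
      by (intro nn_integral_cong) (simp add: indicator_def)
    also have "\<dots> = emeasure lborel {t. x + t *\<^sub>R v \<in> Z}"
      using countable_imp_null_set_lborel[OF lines[of x]] by (intro nn_integral_indicator) auto
    also have "\<dots> = 0" by (rule emeasure_lborel_countable[OF lines])
    finally show ?thesis .
  qed
  have translate: "(\<integral>\<^sup>+x. ?f x t \<partial>lborel) = emeasure lborel Z" for t
  proof -
    have "emeasure lborel Z = (\<integral>\<^sup>+x. indicator Z x \<partial>distr lborel borel ((+) (t *\<^sub>R v)))"
      using Z by (simp add: lborel_distr_plus)
    also have "\<dots> = (\<integral>\<^sup>+x. indicator Z (t *\<^sub>R v + x) \<partial>lborel)"
      using Z by (subst nn_integral_distr) auto
    finally show ?thesis by (simp add: add.commute)
  qed
  have "(\<integral>\<^sup>+t. \<integral>\<^sup>+x. ?f x t \<partial>lborel \<partial>lborel) = (\<integral>\<^sup>+x. \<integral>\<^sup>+t. ?f x t \<partial>lborel \<partial>lborel)"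
    by (rule lborel_pair.Fubini'[OF f])
  then have "emeasure lborel Z = 0"
    by (simp add: line translate)
  then show ?thesis using Z by (auto simp: null_sets_def)
qed

section \<open>Residues and time-frequency shifts\<close>

lemma int_residue: "int (residue j) = to_int_mod_ring (j :: 'n::finite mod_ring)"
  unfolding residue_def by transfer simp

lemma residue_less: "residue (j :: 'n::finite mod_ring) < CARD('n)"
  unfolding residue_def by transfer auto

lemma residue_inject [simp]: "residue i = residue j \<longleftrightarrow> i = (j :: 'n::finite mod_ring)"
  by (metis int_residue of_int_mod_ring_to_int_mod_ring)

lemma residue_of_int_mod_ring: "residue (of_int_mod_ring x :: 'n::finite mod_ring) = nat (x mod CARD('n))"
  unfolding residue_def by transfer simp

lemma residue_diff:
  "int (residue (i - j)) = (int (residue i) - int (residue j)) mod CARD('n)"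
  for i j :: "'n::finite mod_ring"
  unfolding int_residue by transfer simp

lemma bij_betw_residue: "bij_betw residue (UNIV :: 'n::finite mod_ring set) {..<CARD('n)}"
proof -
  have "m \<in> range (residue :: 'n mod_ring \<Rightarrow> nat)" if "m < CARD('n)" for m
    using that by (intro range_eqI[of _ _ "of_int_mod_ring (int m)"]) (simp add: residue_of_int_mod_ring)
  then show ?thesis by (auto simp: bij_betw_def inj_on_def residue_less)
qed

lemma tf_shift_nth:
  fixes \<phi> :: "complex ^ ('n::finite mod_ring)"
  shows "tf_shift (k, l) \<phi> $ j = (unit_root CARD('n) ^ residue l) ^ residue j * \<phi> $ (j - k)"
  by (simp add: tf_shift_def modulation_funpow translation_funpow int_residue
      mult.commute flip: power_mult)

lemma inj_unit_root_power: "inj (\<lambda>l :: 'n::finite mod_ring. unit_root CARD('n) ^ residue l)"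
proof (rule injI)
  fix l m :: "'n mod_ring"
  have exp: "unit_root CARD('n) ^ i = exp (2 * of_real pi * \<i> * of_nat i / of_nat CARD('n))" for i
    by (simp add: unit_root_def mult_ac flip: exp_of_nat_mult)
  assume "unit_root CARD('n) ^ residue l = unit_root CARD('n) ^ residue m"
  then have "[residue l = residue m] (mod CARD('n))"
    unfolding exp by (simp add: complex_root_unity_eq unique_euclidean_semiring_class.cong_def)
  then show "l = m"
    using residue_less[of l] residue_less[of m] by (simp add: unique_euclidean_semiring_class.cong_def)
qed

text \<open>
  Listing the time-frequency shifts by increasing translation parameter is what turns the shifts with
  a common translation into consecutive columns.
\<close>

lemma sorted_enumeration:
  fixes f :: "'a \<Rightarrow> nat"
  assumes "card P = CARD('n)"
  obtains p :: "'n::finite mod_ring \<Rightarrow> 'a" where "bij_betw p UNIV P"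
    and "\<And>i j. residue i \<le> residue j \<Longrightarrow> f (p i) \<le> f (p j)"
proof -
  have "finite P" using assms by (intro card_ge_0_finite) simp
  then obtain ys where ys: "set ys = P" "distinct ys" using finite_distinct_list by blast
  define xs where "xs = sort_key f ys"
  have len: "length xs = CARD('n)"
    using ys assms by (simp add: xs_def flip: distinct_card)
  have "bij_betw ((!) xs) {..<length xs} P"
    by (rule bij_betw_nth) (simp_all add: xs_def ys)
  then have bij: "bij_betw ((!) xs \<circ> residue) (UNIV :: 'n mod_ring set) P"
    using bij_betw_residue unfolding len by (rule bij_betw_trans[rotated])
  have sorted: "sorted (map f xs)" by (simp add: xs_def)
  show thesis
  proof (rule that[OF bij])
    fix i j :: "'n mod_ring" assume "residue i \<le> residue j"
    then show "f (((!) xs \<circ> residue) i) \<le> f (((!) xs \<circ> residue) j)"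
      using sorted_nth_mono[OF sorted, of "residue i" "residue j"] residue_less[of i] residue_less[of j]
      by (simp add: len)
  qed
qed

text \<open>
  As \<open>g\<close> is monotone along the residues, its level sets are intervals. The matrix is therefore block
  diagonal, and the rows of each block are consecutive powers of its distinct nodes. This is the step
  that works for composite \<open>N\<close>, where minors of the Fourier matrix with arbitrary rows can vanish.
\<close>

lemma block_matrix_det_nonzero:
  fixes g :: "'n::finite mod_ring \<Rightarrow> nat" and z :: "'n mod_ring \<Rightarrow> complex"
  assumes mono: "\<And>i j. residue i \<le> residue j \<Longrightarrow> g i \<le> g j"
    and nz: "\<And>l. z l \<noteq> 0"
    and inj: "\<And>l m. g l = g m \<Longrightarrow> z l = z m \<Longrightarrow> l = m"
  shows "det (\<chi> j l. if g j = g l then z l ^ residue j else 0) \<noteq> 0"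
  unfolding det_nonzero_iff_kernel_trivial
proof (intro allI impI)
  fix c :: "complex ^ ('n mod_ring)"
  assume ker: "(\<chi> j l. if g j = g l then z l ^ residue j else 0) *v c = 0"
  have "c $ m = 0" for m
  proof -
    define S where "S = {l. g l = g m}"
    obtain s where s: "s \<in> S" "\<And>l. l \<in> S \<Longrightarrow> residue s \<le> residue l"
      using ex_has_least_nat[of "\<lambda>l. l \<in> S" m residue] by (auto simp: S_def)
    \<comment> \<open>A level set contains the \<open>card S\<close> residues that follow its least one: some element of the set
      lies at or beyond each of these positions, and monotonicity fills the gap.\<close>
    have interval: "\<exists>j\<in>S. residue j = residue s + i" if "i < card S" for i
    proof -
      have "\<not> residue ` S \<subseteq> {residue s..<residue s + i}"
      proof
        assume "residue ` S \<subseteq> {residue s..<residue s + i}"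
        then have "card (residue ` S) \<le> i" using card_mono[of "{residue s..<residue s + i}"] by fastforce
        then show False using that by (simp add: card_image inj_on_def)
      qed
      then obtain l where l: "l \<in> S" "residue s + i \<le> residue l" using s(2) by force
      then have "residue s + i \<in> range (residue :: 'n mod_ring \<Rightarrow> nat)"
        using bij_betw_residue residue_less[of l] by (auto simp: bij_betw_def)
      then obtain j :: "'n mod_ring" where j: "residue j = residue s + i" by (metis rangeE)
      then have "g s \<le> g j" "g j \<le> g l" using l mono by auto
      then show ?thesis using s(1) l(1) j by (auto simp: S_def)
    qed
    have zero: "(\<Sum>l\<in>S. z l ^ (residue s + i) * c $ l) = 0" if i: "i < card S" for i
    proof -
      obtain j where j: "j \<in> S" "residue j = residue s + i" using interval[OF i] by blast
      have "0 = (\<Sum>l\<in>UNIV. (if g j = g l then z l ^ residue j else 0) * c $ l)"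
        using arg_cong[OF ker, of "\<lambda>v. v $ j"] by (simp add: matrix_vector_mult_def)
      also have "\<dots> = (\<Sum>l\<in>S. z l ^ residue j * c $ l)"
        using j(1) by (intro sum.mono_neutral_cong_right) (auto simp: S_def)
      finally show ?thesis by (simp add: j(2))
    qed
    show "c $ m = 0"
      by (rule vandermonde_kernel_trivial[OF _ _ _ zero]) (auto simp: S_def inj_on_def nz intro: inj)
  qed
  then show "c = 0" by (simp add: vec_eq_iff)
qed

section \<open>Gabor matrices\<close>

definition gabor_matrix ::
    "('n::finite mod_ring \<Rightarrow> 'n mod_ring \<times> 'n mod_ring) \<Rightarrow> complex ^ ('n mod_ring)
      \<Rightarrow> complex ^ ('n mod_ring) ^ ('n mod_ring)" where
  "gabor_matrix p \<phi> = (\<chi> j l. tf_shift (p l) \<phi> $ j)"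

text \<open>
  The window \<open>\<Phi> \<beta>\<close> is a sharply peaked Gaussian \<open>exp (- \<beta> w)\<close> on the circle. The potentials factor its
  Gabor matrix as \<open>diag(exp (- \<beta> a)) R diag(exp (- \<beta> b))\<close>, and the entries of \<open>R\<close> carry the damping
  \<open>exp (- \<beta> slack)\<close> with \<open>slack \<ge> 0\<close>. As \<open>\<beta> \<rightarrow> \<infinity>\<close> only the entries of slack zero survive, and these form
  the block Vandermonde matrix. So \<open>R\<close>, and with it the Gabor matrix, is nonsingular for large \<open>\<beta>\<close>.
\<close>

lemma gabor_matrix_nonsingular_exists:
  fixes p :: "'n::finite mod_ring \<Rightarrow> 'n mod_ring \<times> 'n mod_ring"
  assumes "inj p" and mono: "\<And>i j. residue i \<le> residue j \<Longrightarrow> residue (fst (p i)) \<le> residue (fst (p j))"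
  obtains \<phi> where "det (gabor_matrix p \<phi>) \<noteq> 0"
proof -
  define N where "N = int CARD('n)"
  define g where "g = (\<lambda>l. residue (fst (p l)))"
  define z where "z = (\<lambda>l. unit_root CARD('n) ^ residue (snd (p l)))"
  define \<kappa> where "\<kappa> = (\<lambda>l. int (g (of_int_mod_ring l)))"
  have \<kappa>_residue: "\<kappa> (int (residue l)) = int (g l)" for l
    by (simp add: \<kappa>_def int_residue)
  have residue_N: "int (residue l) \<in> {0..<N}" for l :: "'n mod_ring"
    by (simp add: N_def residue_less)
  have "N > 0" by (simp add: N_def)
  moreover have "mono_on {0..<N} \<kappa>"
    by (rule mono_onI) (auto simp: \<kappa>_def g_def N_def residue_of_int_mod_ring intro!: mono nat_mono)
  moreover have "\<kappa> ` {0..<N} \<subseteq> {0..<N}"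
    using residue_N by (auto simp: \<kappa>_def g_def)
  ultimately obtain w a b where "transport_potentials N \<kappa> w a b"
    by (rule circular_transport_potentials)
  then have w_periodic: "\<And>x e. w (x + N * e) = w x"
    and w_ge: "\<And>i l. i \<in> {0..<N} \<Longrightarrow> l \<in> {0..<N} \<Longrightarrow> a i + b l \<le> w (i - \<kappa> l)"
    and w_eq: "\<And>i l. i \<in> {0..<N} \<Longrightarrow> l \<in> {0..<N} \<Longrightarrow> w (i - \<kappa> l) = a i + b l \<longleftrightarrow> \<kappa> i = \<kappa> l"
    unfolding transport_potentials_def by blast+
  define \<Phi> :: "real \<Rightarrow> complex ^ ('n mod_ring)"
    where "\<Phi> = (\<lambda>\<beta>. \<chi> r. of_real (exp (- \<beta> * w (int (residue r)))))"
  define slack where "slack = (\<lambda>(j :: 'n mod_ring) (l :: 'n mod_ring). w (int (residue j) - int (g l)) - a (int (residue j)) - b (int (residue l)))"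
  define R :: "real \<Rightarrow> complex ^ ('n mod_ring) ^ ('n mod_ring)"
    where "R = (\<lambda>\<beta>. \<chi> j l. z l ^ residue j * of_real (exp (- \<beta> * slack j l)))"
  have slack: "slack j l \<ge> 0" "slack j l = 0 \<longleftrightarrow> g j = g l" for j l
    using w_ge[OF residue_N residue_N, of j l] w_eq[OF residue_N residue_N, of j l]
    by (auto simp: slack_def \<kappa>_residue)
  have entry: "gabor_matrix p (\<Phi> \<beta>) $ j $ l
      = exp (- \<beta> * a (int (residue j))) * (R \<beta> $ j $ l * exp (- \<beta> * b (int (residue l))))" for \<beta> j l
  proof -
    let ?x = "int (residue j) - int (g l)"
    \<comment> \<open>Reduction modulo \<open>N\<close> changes the argument by a multiple of the period of \<open>w\<close>.\<close>
    have "int (residue (j - fst (p l))) = ?x + N * (- (?x div N))"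
      by (simp add: residue_diff g_def N_def flip: minus_mult_div_eq_mod)
    then have "w (int (residue (j - fst (p l)))) = w ?x" by (simp only: w_periodic)
    then have "gabor_matrix p (\<Phi> \<beta>) $ j $ l = z l ^ residue j * exp (- \<beta> * w ?x)"
      by (simp add: gabor_matrix_def \<Phi>_def z_def tf_shift_nth[of "fst (p l)" "snd (p l)", simplified])
    also have "w ?x = a (int (residue j)) + slack j l + b (int (residue l))" by (simp add: slack_def)
    finally show ?thesis by (simp add: R_def exp_add exp_diff exp_minus field_simps distrib_left)
  qed
  let ?B = "\<chi> j l. if g j = g l then z l ^ residue j else 0"
  have "((\<lambda>\<beta>. det (R \<beta>)) \<longlongrightarrow> det ?B) at_top"
  proof (rule tendsto_det)
    fix j l
    show "((\<lambda>\<beta>. R \<beta> $ j $ l) \<longlongrightarrow> ?B $ j $ l) at_top"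
    proof (cases "g j = g l")
      case True
      then show ?thesis using slack(2)[of j l] by (simp add: R_def)
    next
      case False
      then have "slack j l > 0" using slack[of j l] by (simp add: less_le)
      then have "((\<lambda>\<beta>. exp (- \<beta> * slack j l)) \<longlongrightarrow> 0) at_top" by real_asymp
      then have "((\<lambda>\<beta>. z l ^ residue j * of_real (exp (- \<beta> * slack j l))) \<longlongrightarrow> z l ^ residue j * of_real 0) at_top"
        by (intro tendsto_intros)
      then show ?thesis using False by (simp add: R_def)
    qed
  qed
  moreover have "det ?B \<noteq> 0"
  proof (rule block_matrix_det_nonzero)
    show "residue i \<le> residue j \<Longrightarrow> g i \<le> g j" for i j by (simp add: g_def mono)
    show "z l \<noteq> 0" for l by (simp add: z_def unit_root_def)
    show "l = m" if "g l = g m" "z l = z m" for l m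
    proof -
      have "fst (p l) = fst (p m)" "snd (p l) = snd (p m)"
        using that injD[OF inj_unit_root_power] by (auto simp: g_def z_def)
      then show ?thesis using \<open>inj p\<close> by (metis injD prod_eqI)
    qed
  qed
  ultimately have "eventually (\<lambda>\<beta>. det (R \<beta>) \<noteq> 0) at_top" by (rule tendsto_imp_eventually_ne)
  then obtain \<beta> where \<beta>: "det (R \<beta>) \<noteq> 0" using eventually_happens by force
  have "det (gabor_matrix p (\<Phi> \<beta>)) \<noteq> 0"
    unfolding det_nonzero_iff_kernel_trivial
  proof (intro allI impI)
    fix x assume ker: "gabor_matrix p (\<Phi> \<beta>) *v x = 0"
    define y :: "complex ^ ('n mod_ring)" where "y = (\<chi> l. exp (- \<beta> * b (int (residue l))) * x $ l)"
    have "R \<beta> *v y = 0"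
      unfolding vec_eq_iff
    proof
      fix j
      have "0 = (\<Sum>l\<in>UNIV. gabor_matrix p (\<Phi> \<beta>) $ j $ l * x $ l)"
        using arg_cong[OF ker, of "\<lambda>v. v $ j"] by (simp add: matrix_vector_mult_def)
      also have "\<dots> = exp (- \<beta> * a (int (residue j))) * (\<Sum>l\<in>UNIV. R \<beta> $ j $ l * y $ l)"
        unfolding entry y_def by (simp add: sum_distrib_left mult_ac)
      finally show "(R \<beta> *v y) $ j = 0 $ j" by (simp add: matrix_vector_mult_def)
    qed
    then have "y = 0" using \<beta> by (simp add: det_nonzero_iff_kernel_trivial)
    then show "x = 0" by (simp add: y_def vec_eq_iff)
  qed
  then show thesis by (rule that)
qed

text \<open>
  Along each line in the direction of a window with nonsingular Gabor matrix, the matrix depends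
  affinely on the parameter with that nonsingular matrix as slope, so only finitely many points of
  the line are singular.
\<close>

lemma gabor_singular_null_set:
  fixes p :: "'n::finite mod_ring \<Rightarrow> 'n mod_ring \<times> 'n mod_ring"
  assumes "det (gabor_matrix p \<psi>) \<noteq> 0"
  shows "{\<phi>. det (gabor_matrix p \<phi>) = 0} \<in> null_sets lborel"
proof (rule null_set_if_null_on_parallel_lines[where v = \<psi>])
  have nth: "tf_shift q \<phi> $ j = (unit_root CARD('n) ^ residue (snd q)) ^ residue j * \<phi> $ (j - fst q)"
    for q j and \<phi> :: "complex ^ ('n mod_ring)"
    using tf_shift_nth[of "fst q" "snd q" \<phi> j] by simp
  have "closed {\<phi>. det (gabor_matrix p \<phi>) = 0}"
    unfolding gabor_matrix_def det_def
    by (intro closed_Collect_eq) (auto simp: nth intro!: continuous_intros)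
  then show "{\<phi>. det (gabor_matrix p \<phi>) = 0} \<in> sets borel" by simp
  fix \<phi>
  have "gabor_matrix p (\<phi> + t *\<^sub>R \<psi>)
      = (\<chi> i j. gabor_matrix p \<phi> $ i $ j + of_real t * gabor_matrix p \<psi> $ i $ j)" for t
    by (simp add: gabor_matrix_def nth vec_eq_iff algebra_simps scaleR_conv_of_real[where 'a = complex])
  then show "countable {t. \<phi> + t *\<^sub>R \<psi> \<in> {\<phi>. det (gabor_matrix p \<phi>) = 0}}"
    using finite_singular_on_line[OF assms] by (simp add: countable_finite)
qed

theorem theorem1p2:
  shows "(\<exists>\<phi> :: complex ^ ('n::finite mod_ring). general_linear_position \<phi> UNIV) \<and>
    {\<phi> :: complex ^ ('n mod_ring). \<not> general_linear_position \<phi> UNIV} \<in> null_sets lebesgue"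
proof -
  let ?bad = "{\<phi> :: complex ^ ('n mod_ring). \<not> general_linear_position \<phi> UNIV}"
  let ?dependent = "\<lambda>P. {\<phi> :: complex ^ ('n mod_ring). \<not> basis_family (\<lambda>q. tf_shift q \<phi>) P}"
  have "negligible (?dependent P)" if P: "card P = CARD('n)" for P :: "('n mod_ring \<times> 'n mod_ring) set"
  proof -
    obtain p :: "'n mod_ring \<Rightarrow> 'n mod_ring \<times> 'n mod_ring" where p: "bij_betw p UNIV P"
      and mono: "\<And>i j. residue i \<le> residue j \<Longrightarrow> residue (fst (p i)) \<le> residue (fst (p j))"
      using sorted_enumeration[OF P, of "\<lambda>q. residue (fst q)"] by blast
    obtain \<psi> where "det (gabor_matrix p \<psi>) \<noteq> 0"
      using gabor_matrix_nonsingular_exists[OF bij_betw_imp_inj_on[OF p] mono] by blast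
    then have "{\<phi>. det (gabor_matrix p \<phi>) = 0} \<in> null_sets lborel"
      by (rule gabor_singular_null_set)
    then have "negligible {\<phi>. det (gabor_matrix p \<phi>) = 0}"
      by (simp add: negligible_iff_null_sets null_sets_completionI)
    moreover have "basis_family (\<lambda>q. tf_shift q \<phi>) P" if "det (gabor_matrix p \<phi>) \<noteq> 0" for \<phi>
      using basis_family_if_det_nonzero[OF p, of "\<lambda>q. tf_shift q \<phi>"] that
      by (simp add: gabor_matrix_def)
    then have "?dependent P \<subseteq> {\<phi>. det (gabor_matrix p \<phi>) = 0}" by blast
    ultimately show ?thesis by (rule negligible_subset)
  qed
  then have "negligible (\<Union>P\<in>{P. card P = CARD('n)}. ?dependent P)"
    by (intro negligible_Union) auto
  then have bad: "negligible ?bad"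
    by (rule negligible_subset) (auto simp: general_linear_position_def)
  then have "?bad \<noteq> UNIV" by (metis non_negligible_UNIV)
  then show ?thesis using bad by (auto simp: negligible_iff_null_sets)
qed

end
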